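(* Fix $b>0$ and, for each integer $n\ge b$, let $p_n=b/n\in(0,1]$ and let $G_n=(D_n,S_n,E_n)$ be the random bipartite graph with $D_n=S_n=\{1,\dots,n\}$ (dispatchers and servers, respectively) such that the indicators $\mathbf{1}\{(d,u)\in E_n\}$, $d\in D_n$, $u\in S_n$, are independent with mean $p_n$. All dispatchers have arrival rate $\lambda>0$ and all servers have service rate $\mu>\lambda$. Let the random bipartite graphs $\{G_n:n\ge b\}$ be independent and defined on a common probability space. For each $n\ge b$, fix a server $u_n\in S_n$ with maximum degree. Also, fix an integer $a\ge1$ and let $\alpha=(a,\lambda,\mu)$. With probability one, there exists an infinite set $\mathcal{M}\subset\mathbb{N}$ such that the servers $\{u_m:m\in\mathcal{M}\}$ have a skewed neighborhood; more specifically, $$\lim_{m\to\infty,\ m\in\mathcal{M}}|\mathcal{N}_m^\alpha(u_m)|=\infty.$$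
   Context: For $d\in D_n$, $\mathcal{N}_n(d)=\{u\in S_n:(d,u)\in E_n\}$; for $u\in S_n$, $\mathcal{N}_n(u)=\{d\in D_n:(d,u)\in E_n\}$; $\deg_n$ denotes the cardinality of these sets. In general, for arrival rates $\lambda_n(\cdot)$ and service rates $\mu_n(\cdot)$ and $\alpha=(a,\lambda_{\min},\mu_{\max})$, $$\mathcal{N}_n^\alpha(u)=\{d\in\mathcal{N}_n(u):\deg_n(d)\le a,\ \lambda_n(d)\ge\lambda_{\min}\text{ and }\mu_n(v)\le\mu_{\max}\ \forall v\in\mathcal{N}_n(d)\},$$ and servers $u_n\in S_n$ (for $n$ in an infinite index set) have a skewed neighborhood if $|\mathcal{N}_n^\alpha(u_n)|\to\infty$ for some fixed $\alpha$. Here rates are constant and $\alpha=(a,\lambda,\mu)$, so $\mathcal{N}_n^\alpha(u)=\{d\in\mathcal{N}_n(u):\deg_n(d)\le a\}$. The set $\mathcal{M}$ may depend on the realization of the graphs. *)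

theory Defs
  imports "HOL-Probability.Probability"
begin

record ('d, 's) bigraph =
  dispatchers :: "'d set"
  servers :: "'s set"
  edges :: "('d \<times> 's) set"

definition wf_bigraph :: "('d, 's) bigraph \<Rightarrow> bool" where
  "wf_bigraph G \<longleftrightarrow> edges G \<subseteq> dispatchers G \<times> servers G"

definition dispatcher_nbrs :: "('d, 's) bigraph \<Rightarrow> 'd \<Rightarrow> 's set" where
  "dispatcher_nbrs G d = {u \<in> servers G. (d, u) \<in> edges G}"

definition server_nbrs :: "('d, 's) bigraph \<Rightarrow> 's \<Rightarrow> 'd set" where
  "server_nbrs G u = {d \<in> dispatchers G. (d, u) \<in> edges G}"

definition dispatcher_deg :: "('d, 's) bigraph \<Rightarrow> 'd \<Rightarrow> nat" where
  "dispatcher_deg G d = card (dispatcher_nbrs G d)"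

definition server_deg :: "('d, 's) bigraph \<Rightarrow> 's \<Rightarrow> nat" where
  "server_deg G u = card (server_nbrs G u)"

definition max_degree_server :: "('d, 's) bigraph \<Rightarrow> 's \<Rightarrow> bool" where
  "max_degree_server G u \<longleftrightarrow>
     u \<in> servers G \<and> (\<forall>v\<in>servers G. server_deg G v \<le> server_deg G u)"

text \<open>The arguments \<open>lam\<close> and \<open>mu\<close> are the arrival and service rates, and the triple is
  \<open>\<alpha> = (a, \<lambda>\<^sub>m\<^sub>i\<^sub>n, \<mu>\<^sub>m\<^sub>a\<^sub>x)\<close>.\<close>

definition alpha_nbrs ::
  "('d, 's) bigraph \<Rightarrow> ('d \<Rightarrow> real) \<Rightarrow> ('s \<Rightarrow> real) \<Rightarrow> nat \<times> real \<times> real \<Rightarrow> 's \<Rightarrow> 'd set" where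
  "alpha_nbrs G lam mu \<alpha> u = (case \<alpha> of (a, lam_min, mu_max) \<Rightarrow>
     {d \<in> server_nbrs G u. dispatcher_deg G d \<le> a \<and> lam_min \<le> lam d \<and>
        (\<forall>v \<in> dispatcher_nbrs G d. mu v \<le> mu_max)})"

text \<open>The filter \<open>inf sequentially (principal I)\<close> expresses that the index tends to infinity
  inside \<open>I\<close>; it is nontrivial exactly when \<open>I\<close> is infinite.\<close>

definition skewed_neighborhood ::
  "nat set \<Rightarrow> (nat \<Rightarrow> ('d, 's) bigraph) \<Rightarrow> (nat \<Rightarrow> 'd \<Rightarrow> real) \<Rightarrow> (nat \<Rightarrow> 's \<Rightarrow> real) \<Rightarrow>
     (nat \<Rightarrow> 's) \<Rightarrow> bool" where
  "skewed_neighborhood I G lam mu u \<longleftrightarrow> infinite I \<and>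
     (\<exists>\<alpha>. filterlim (\<lambda>n. card (alpha_nbrs (G n) (lam n) (mu n) \<alpha> (u n)))
             at_top (inf sequentially (principal I)))"

end

theory Submission
  imports Defs "HOL-Real_Asymp.Real_Asymp"
begin

text \<open>
  For each \<open>D\<close> choose \<open>n\<close> near \<open>D \<cdot> D! / b\<^sup>D\<close>, so that the expected number of servers of degree
  at least \<open>D\<close> is of order \<open>D\<close>. Since the degrees of the servers are independent, some server
  then has degree \<open>D\<close> with probability close to one. A dispatcher next to a given server has no
  other neighbour with probability bounded away from zero (near \<open>exp (- b)\<close>), independently over
  dispatchers, so a given set of \<open>D\<close> neighbours contains fewer than \<open>k\<close> of degree one with
  probability exponentially small in \<open>D\<close>. The union bound over all servers and all \<open>D\<close>-sets costs
  only a factor of order \<open>D\<close>; hence, along this sequence of \<open>n\<close>, every server of maximum degree has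
  at least \<open>k\<close> neighbours of degree one with probability tending to one. For each \<open>k\<close> this happens
  almost surely for infinitely many \<open>n\<close>, and a diagonal choice gives the index set.
\<close>

section \<open>Independence of events on disjoint groups of coordinates\<close>

text \<open>By the last hypothesis, \<open>Q j\<close> reads only the coordinates in
  \<open>K j\<close>, and families of variables restricted to disjoint groups are independent. Since
  \<open>'b\<close> and each \<open>K j\<close> are finite, the product sigma-algebra on each group
  is discrete, so every predicate on it is measurable.\<close>

lemma (in prob_space) prob_Ball_disjoint_groups:
  fixes X :: "'i \<Rightarrow> 'a \<Rightarrow> 'b::finite"
  assumes indep: "indep_vars (\<lambda>_. count_space UNIV) X I"
    and J: "finite J" "disjoint_family_on K J"
    and K: "\<And>j. j \<in> J \<Longrightarrow> finite (K j) \<and> K j \<subseteq> I"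
    and Q: "\<And>j f. j \<in> J \<Longrightarrow> Q j (restrict f (K j)) = Q j f"
  shows "prob {\<omega> \<in> space M. \<forall>j\<in>J. Q j (\<lambda>i. X i \<omega>)} =
    (\<Prod>j\<in>J. prob {\<omega> \<in> space M. Q j (\<lambda>i. X i \<omega>)})"
proof (cases "J = {}")
  case True
  then show ?thesis by (simp add: prob_space)
next
  case False
  let ?A = "\<lambda>j. {f \<in> K j \<rightarrow>\<^sub>E UNIV. Q j f}"
  let ?R = "\<lambda>j \<omega>. \<lambda>i\<in>K j. X i \<omega>"
  have vars: "indep_vars (\<lambda>j. PiM (K j) (\<lambda>_. count_space UNIV)) ?R J"
    using indep_vars_restrict[OF indep _ J(2)] K by blast
  have pre: "?R j -` ?A j \<inter> space M = {\<omega> \<in> space M. Q j (\<lambda>i. X i \<omega>)}" if "j \<in> J" for j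
    using Q[OF that] by auto
  have "prob (\<Inter>j\<in>J. ?R j -` ?A j \<inter> space M) = (\<Prod>j\<in>J. prob (?R j -` ?A j \<inter> space M))"
    by (rule indep_varsD_finite[OF vars False J(1)]) (simp add: K count_space_PiM_finite)
  moreover have "(\<Inter>j\<in>J. ?R j -` ?A j \<inter> space M) = {\<omega> \<in> space M. \<forall>j\<in>J. Q j (\<lambda>i. X i \<omega>)}"
    using pre False by blast
  ultimately show ?thesis by (simp only: pre cong: prod.cong)
qed

section \<open>Degrees and neighborhoods in one random bipartite graph\<close>

text \<open>Quantifying over every server of maximum degree makes this a property of the graph
  alone, so it defines an event whichever way a server of maximum degree is selected.\<close>

definition skewed :: "nat \<Rightarrow> nat \<Rightarrow> (nat, nat) bigraph \<Rightarrow> bool" where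
  "skewed a k g \<longleftrightarrow> (\<forall>v. max_degree_server g v \<longrightarrow>
     k \<le> card {d \<in> server_nbrs g v. dispatcher_deg g d \<le> a})"

text \<open>This is a single graph of the sequence. Graphs carry the discrete sigma-algebra, so
  every property of the graph is an event; edges are Boolean variables, which fits the finite value
  type of \<open>prob_Ball_disjoint_groups\<close>.\<close>

locale random_bigraph = prob_space M for M :: "'a measure" +
  fixes H :: "'a \<Rightarrow> (nat, nat) bigraph" and n :: nat and p :: real
  assumes measurable_graph: "H \<in> measurable M (count_space UNIV)"
    and vertices: "\<omega> \<in> space M \<Longrightarrow> dispatchers (H \<omega>) = {1..n}"
      "\<omega> \<in> space M \<Longrightarrow> servers (H \<omega>) = {1..n}"
    and indep_edges:
      "indep_vars (\<lambda>_. count_space UNIV) (\<lambda>e \<omega>. e \<in> edges (H \<omega>)) ({1..n} \<times> {1..n})"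
    and prob_edge:
      "e \<in> {1..n} \<times> {1..n} \<Longrightarrow> prob {\<omega> \<in> space M. e \<in> edges (H \<omega>)} = p"
begin

lemma event [simp, intro]: "{\<omega> \<in> space M. P (H \<omega>)} \<in> events"
proof -
  have "{\<omega> \<in> space M. P (H \<omega>)} = H -` Collect P \<inter> space M" by auto
  then show ?thesis using measurable_sets[OF measurable_graph, of "Collect P"] by simp
qed

lemma prob_not: "prob {\<omega> \<in> space M. \<not> P (H \<omega>)} = 1 - prob {\<omega> \<in> space M. P (H \<omega>)}"
proof -
  have "space M - {\<omega> \<in> space M. P (H \<omega>)} = {\<omega> \<in> space M. \<not> P (H \<omega>)}" by auto
  then show ?thesis using prob_compl[OF event[of P]] by simp
qed

lemma prob_pattern:
  assumes E: "A \<subseteq> {1..n} \<times> {1..n}" "B \<subseteq> {1..n} \<times> {1..n}" and "A \<inter> B = {}"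
  shows "prob {\<omega> \<in> space M. A \<subseteq> edges (H \<omega>) \<and> B \<inter> edges (H \<omega>) = {}} = p ^ card A * (1 - p) ^ card B"
proof -
  have fin: "finite A" "finite B"
    using E by (meson finite_SigmaI finite_atLeastAtMost finite_subset)+
  let ?Q = "\<lambda>e f. f e = (e \<in> A)"
  have "prob {\<omega> \<in> space M. \<forall>e\<in>A \<union> B. ?Q e (\<lambda>e. e \<in> edges (H \<omega>))}
      = (\<Prod>e\<in>A \<union> B. prob {\<omega> \<in> space M. ?Q e (\<lambda>e. e \<in> edges (H \<omega>))})"
    by (rule prob_Ball_disjoint_groups[OF indep_edges, where K = "\<lambda>e. {e}"])
      (use fin E in \<open>auto simp: disjoint_family_on_def\<close>)
  also have "\<dots> = (\<Prod>e\<in>A. prob {\<omega> \<in> space M. e \<in> edges (H \<omega>)})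
      * (\<Prod>e\<in>B. prob {\<omega> \<in> space M. e \<notin> edges (H \<omega>)})"
    using assms(3) fin by (subst prod.union_disjoint) (auto intro!: arg_cong2[of _ _ _ _ "(*)"] prod.cong arg_cong[of _ _ prob])
  also have "\<dots> = p ^ card A * (1 - p) ^ card B"
    using E by (simp add: prob_edge prob_not[of "\<lambda>g. e \<in> edges g" for e] subset_eq del: mem_Sigma_iff)
  also have "{\<omega> \<in> space M. \<forall>e\<in>A \<union> B. ?Q e (\<lambda>e. e \<in> edges (H \<omega>))}
      = {\<omega> \<in> space M. A \<subseteq> edges (H \<omega>) \<and> B \<inter> edges (H \<omega>) = {}}"
    using assms(3) by auto
  finally show ?thesis .
qed

lemma server_nbrs_eq:
  "\<omega> \<in> space M \<Longrightarrow> server_nbrs (H \<omega>) v = {d \<in> {1..n}. (d, v) \<in> edges (H \<omega>)}"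
  by (simp add: server_nbrs_def vertices)

lemma prob_server_nbrs:
  assumes v: "v \<in> {1..n}" and T: "T \<subseteq> {1..n}"
  shows "prob {\<omega> \<in> space M. server_nbrs (H \<omega>) v = T} = p ^ card T * (1 - p) ^ (n - card T)"
proof -
  let ?A = "T \<times> {v}" and ?B = "({1..n} - T) \<times> {v}"
  have "{\<omega> \<in> space M. server_nbrs (H \<omega>) v = T}
      = {\<omega> \<in> space M. ?A \<subseteq> edges (H \<omega>) \<and> ?B \<inter> edges (H \<omega>) = {}}"
    using T by (auto simp: server_nbrs_eq set_eq_iff subset_eq)
  moreover have "card ({1..n} - T) = n - card T"
    using T by (simp add: card_Diff_subset finite_subset)
  moreover have "?A \<subseteq> {1..n} \<times> {1..n}" "?B \<subseteq> {1..n} \<times> {1..n}" "?A \<inter> ?B = {}"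
    using v T by auto
  ultimately show ?thesis
    using prob_pattern[of ?A ?B] by (simp add: card_cartesian_product)
qed

lemma prob_server_deg:
  assumes v: "v \<in> {1..n}"
  shows "prob {\<omega> \<in> space M. server_deg (H \<omega>) v = D} = (n choose D) * p ^ D * (1 - p) ^ (n - D)"
proof -
  let ?S = "{T. T \<subseteq> {1..n} \<and> card T = D}"
  have "{\<omega> \<in> space M. server_deg (H \<omega>) v = D} = (\<Union>T\<in>?S. {\<omega> \<in> space M. server_nbrs (H \<omega>) v = T})"
    by (auto simp: server_deg_def server_nbrs_eq)
  also have "prob \<dots> = (\<Sum>T\<in>?S. prob {\<omega> \<in> space M. server_nbrs (H \<omega>) v = T})"
    by (rule finite_measure_finite_Union) (auto simp: disjoint_family_on_def)
  also have "\<dots> = (\<Sum>T\<in>?S. p ^ D * (1 - p) ^ (n - D))"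
    using v by (intro sum.cong) (auto simp: prob_server_nbrs)
  also have "\<dots> = (n choose D) * p ^ D * (1 - p) ^ (n - D)"
    by (simp add: n_subsets)
  finally show ?thesis .
qed

text \<open>The possible edges at distinct servers form disjoint columns
  \<open>{1..n} \<times> {v}\<close>, hence the degrees of the servers are independent.\<close>

lemma prob_all_server_deg_ne:
  "prob {\<omega> \<in> space M. \<forall>v\<in>{1..n}. server_deg (H \<omega>) v \<noteq> D}
    = (1 - (n choose D) * p ^ D * (1 - p) ^ (n - D)) ^ n"
proof -
  let ?Q = "\<lambda>v f. card {d \<in> {1..n}. f (d, v)} \<noteq> D"
  let ?X = "\<lambda>\<omega> e. e \<in> edges (H \<omega>)"
  have "prob {\<omega> \<in> space M. \<forall>v\<in>{1..n}. ?Q v (?X \<omega>)} = (\<Prod>v\<in>{1..n}. prob {\<omega> \<in> space M. ?Q v (?X \<omega>)})"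
    by (rule prob_Ball_disjoint_groups[OF indep_edges, where K = "\<lambda>v. {1..n} \<times> {v}"])
      (auto simp: disjoint_family_on_def restrict_def cong: conj_cong)
  also have "\<dots> = (\<Prod>v\<in>{1..n}. prob {\<omega> \<in> space M. server_deg (H \<omega>) v \<noteq> D})"
    by (auto simp: server_deg_def server_nbrs_eq intro!: prod.cong arg_cong[of _ _ prob])
  also have "\<dots> = (1 - (n choose D) * p ^ D * (1 - p) ^ (n - D)) ^ n"
    by (simp add: prob_not[of "\<lambda>g. server_deg g v = D" for v] prob_server_deg del: One_nat_def)
  also have "{\<omega> \<in> space M. \<forall>v\<in>{1..n}. ?Q v (?X \<omega>)}
     = {\<omega> \<in> space M. \<forall>v\<in>{1..n}. server_deg (H \<omega>) v \<noteq> D}"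
    by (auto simp: server_deg_def server_nbrs_eq)
  finally show ?thesis .
qed

lemma prob_all_server_deg_ne_le:
  "prob {\<omega> \<in> space M. \<forall>v\<in>{1..n}. server_deg (H \<omega>) v \<noteq> D}
    \<le> exp (- (n * ((n choose D) * p ^ D * (1 - p) ^ (n - D))))"
proof (cases "n = 0")
  case False
  let ?q = "(n choose D) * p ^ D * (1 - p) ^ (n - D)"
  \<comment> \<open>As the probability that server 1 has degree \<open>D\<close>, \<open>?q\<close>
    is at most 1; this gives the nonnegative base that \<open>power_mono\<close> requires.\<close>
  have "?q \<le> 1"
    using prob_server_deg[of 1 D, symmetric] False by simp
  then have "(1 - ?q) ^ n \<le> exp (- ?q) ^ n"
    using exp_ge_add_one_self[of "- ?q"] by (intro power_mono) auto
  then show ?thesis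
    by (simp add: prob_all_server_deg_ne exp_of_nat_mult[symmetric] del: One_nat_def)
qed simp

lemma prob_other_nbr:
  assumes v: "v \<in> {1..n}" and d: "d \<in> {1..n}"
  shows "prob {\<omega> \<in> space M. \<exists>w\<in>{1..n} - {v}. (d, w) \<in> edges (H \<omega>)} = 1 - (1 - p) ^ (n - 1)"
proof -
  let ?B = "{d} \<times> ({1..n} - {v})"
  have "{\<omega> \<in> space M. {} \<subseteq> edges (H \<omega>) \<and> ?B \<inter> edges (H \<omega>) = {}}
      = {\<omega> \<in> space M. \<not> (\<exists>w\<in>{1..n} - {v}. (d, w) \<in> edges (H \<omega>))}"
    by auto
  moreover have "?B \<subseteq> {1..n} \<times> {1..n}" "card ?B = n - 1"
    using v d by (auto simp: card_cartesian_product)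
  ultimately have "(1 - p) ^ (n - 1) = prob {\<omega> \<in> space M. \<not> (\<exists>w\<in>{1..n} - {v}. (d, w) \<in> edges (H \<omega>))}"
    using prob_pattern[of "{}" ?B] by simp
  then show ?thesis
    using prob_not[of "\<lambda>g. \<exists>w\<in>{1..n} - {v}. (d, w) \<in> edges g"] by simp
qed

text \<open>Leaving \<open>v\<close> out of the range of \<open>w\<close> separates the edges to
  \<open>v\<close> from the further edges of the dispatchers, so all the conditions concern disjoint
  sets of edges and the probabilities multiply.\<close>

lemma prob_many_shared_nbrs:
  assumes v: "v \<in> {1..n}" and T: "T \<subseteq> {1..n}" and L: "L \<subseteq> T"
  shows "prob {\<omega> \<in> space M. (\<forall>d\<in>T. (d, v) \<in> edges (H \<omega>)) \<and>
      (\<forall>d\<in>T - L. \<exists>w\<in>{1..n} - {v}. (d, w) \<in> edges (H \<omega>))}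
    = p ^ card T * (1 - (1 - p) ^ (n - 1)) ^ (card T - card L)"
proof -
  have fin: "finite T" "finite L" using T L by (meson finite_atLeastAtMost finite_subset)+
  \<comment> \<open>The left copy of \<open>d\<close> stands for the edge to \<open>v\<close>, the
    right copy for the edges from \<open>d\<close> to all other servers.\<close>
  let ?J = "T <+> (T - L)"
  let ?K = "case_sum (\<lambda>d. {(d, v)}) (\<lambda>d. {d} \<times> ({1..n} - {v}))"
  let ?Q = "case_sum (\<lambda>d f. f (d, v)) (\<lambda>d f. \<exists>w\<in>{1..n} - {v}. f (d, w))"
  let ?X = "\<lambda>\<omega> e. e \<in> edges (H \<omega>)"
  have "prob {\<omega> \<in> space M. \<forall>j\<in>?J. ?Q j (?X \<omega>)} = (\<Prod>j\<in>?J. prob {\<omega> \<in> space M. ?Q j (?X \<omega>)})"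
    by (rule prob_Ball_disjoint_groups[OF indep_edges, where K = ?K])
      (use fin v T in \<open>auto simp: disjoint_family_on_def\<close>)
  also have "\<dots> = (\<Prod>d\<in>T. prob {\<omega> \<in> space M. (d, v) \<in> edges (H \<omega>)})
      * (\<Prod>d\<in>T - L. prob {\<omega> \<in> space M. \<exists>w\<in>{1..n} - {v}. (d, w) \<in> edges (H \<omega>)})"
    using fin by (simp add: prod.Plus)
  also have "(\<Prod>d\<in>T. prob {\<omega> \<in> space M. (d, v) \<in> edges (H \<omega>)}) = p ^ card T"
    using v T by (simp add: prob_edge subset_eq)
  also have "(\<Prod>d\<in>T - L. prob {\<omega> \<in> space M. \<exists>w\<in>{1..n} - {v}. (d, w) \<in> edges (H \<omega>)})
      = (\<Prod>d\<in>T - L. 1 - (1 - p) ^ (n - 1))"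
    using v T by (intro prod.cong refl prob_other_nbr) auto
  also have "\<dots> = (1 - (1 - p) ^ (n - 1)) ^ (card T - card L)"
    using fin L by (simp add: card_Diff_subset)
  also have "{\<omega> \<in> space M. \<forall>j\<in>?J. ?Q j (?X \<omega>)} = {\<omega> \<in> space M. (\<forall>d\<in>T. (d, v) \<in> edges (H \<omega>)) \<and>
      (\<forall>d\<in>T - L. \<exists>w\<in>{1..n} - {v}. (d, w) \<in> edges (H \<omega>))}"
    by (auto simp: Plus_def ball_Un)
  finally show ?thesis .
qed

text \<open>Fewer than \<open>k\<close> dispatchers of degree at most \<open>a\<close> around a server of degree at least \<open>D\<close>
  leave, among some \<open>D\<close> of its neighbours, \<open>D - k\<close> that have a further neighbour.\<close>

lemma not_skewedE:
  assumes \<omega>: "\<omega> \<in> space M" and a: "a \<ge> 1" and kD: "k \<le> D"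
    and deg: "v \<in> {1..n}" "server_deg (H \<omega>) v = D" and bad: "\<not> skewed a k (H \<omega>)"
  obtains u T L where "u \<in> {1..n}" "T \<subseteq> {1..n}" "card T = D" "L \<subseteq> T" "card L = k"
    "\<forall>d\<in>T. (d, u) \<in> edges (H \<omega>)" "\<forall>d\<in>T - L. \<exists>w\<in>{1..n} - {u}. (d, w) \<in> edges (H \<omega>)"
proof -
  obtain u where u: "max_degree_server (H \<omega>) u"
    and few: "card {d \<in> server_nbrs (H \<omega>) u. dispatcher_deg (H \<omega>) d \<le> a} < k"
    using bad by (auto simp: skewed_def not_le)
  let ?N = "server_nbrs (H \<omega>) u" and ?S = "{d \<in> server_nbrs (H \<omega>) u. dispatcher_deg (H \<omega>) d \<le> a}"
  have un: "u \<in> {1..n}" and "D \<le> card ?N"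
    using u deg \<omega> by (auto simp: max_degree_server_def server_deg_def vertices)
  then obtain T where T: "T \<subseteq> ?N" "card T = D" by (meson obtain_subset_with_card_n)
  have Tn: "T \<subseteq> {1..n}" using T \<omega> by (auto simp: server_nbrs_eq)
  have "finite ?S" using \<omega> by (simp add: server_nbrs_eq)
  then have "card (T \<inter> ?S) \<le> k"
    using few card_mono[of ?S "T \<inter> ?S"] by auto
  moreover have "k \<le> card T" "T \<inter> ?S \<subseteq> T" "finite T"
    using kD T(2) finite_subset[OF Tn] by auto
  \<comment> \<open>Padding the set of low-degree dispatchers in \<open>T\<close> to exactly
    \<open>k\<close> elements lets the union bound count the choices of \<open>L\<close> by
    \<open>D choose k\<close>.\<close>
  ultimately obtain L where L: "T \<inter> ?S \<subseteq> L" "L \<subseteq> T" "card L = k"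
    using exists_subset_between[of "T \<inter> ?S" k T] by blast
  have "\<exists>w\<in>{1..n} - {u}. (d, w) \<in> edges (H \<omega>)" if "d \<in> T - L" for d
  proof (rule ccontr)
    assume "\<not> ?thesis"
    \<comment> \<open>A dispatcher without a neighbour other than \<open>u\<close> has degree at
      most 1, hence at most \<open>a\<close>, and so already lies in \<open>L\<close>.\<close>
    then have "dispatcher_nbrs (H \<omega>) d \<subseteq> {u}" using \<omega> by (auto simp: dispatcher_nbrs_def vertices)
    then have "dispatcher_deg (H \<omega>) d \<le> 1"
      using card_mono[of "{u}"] by (simp add: dispatcher_deg_def)
    with that L T a show False by auto
  qed
  then show thesis
    using that[OF un Tn T(2) L(2,3)] T(1) \<omega> by (auto simp: server_nbrs_eq)
qed

text \<open>The first term covers the case that no server has degree exactly \<open>D\<close>.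
  Otherwise \<open>not_skewedE\<close> yields a triple \<open>(u, T, L)\<close>, and the second term
  is the union bound: the number of triples times the probability from
  \<open>prob_many_shared_nbrs\<close>.\<close>

lemma prob_not_skewed_le:
  assumes a: "a \<ge> 1" and kD: "k \<le> D"
  shows "prob {\<omega> \<in> space M. \<not> skewed a k (H \<omega>)}
    \<le> exp (- (n * ((n choose D) * p ^ D * (1 - p) ^ (n - D))))
      + real n * (n choose D) * (D choose k) * p ^ D * (1 - (1 - p) ^ (n - 1)) ^ (D - k)"
proof -
  let ?none = "{\<omega> \<in> space M. \<forall>v\<in>{1..n}. server_deg (H \<omega>) v \<noteq> D}"
  let ?S = "{T. T \<subseteq> {1..n} \<and> card T = D}"
  let ?L = "\<lambda>T. {L. L \<subseteq> T \<and> card L = k}"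
  let ?B = "\<lambda>(u, T, L). {\<omega> \<in> space M. (\<forall>d\<in>T. (d, u) \<in> edges (H \<omega>)) \<and>
      (\<forall>d\<in>T - L. \<exists>w\<in>{1..n} - {u}. (d, w) \<in> edges (H \<omega>))}"
  let ?I = "{1..n} \<times> Sigma ?S ?L"
  let ?c = "p ^ D * (1 - (1 - p) ^ (n - 1)) ^ (D - k)"
  have finS: "finite ?S" by simp
  have finT: "finite T" if "T \<in> ?S" for T using that by (auto intro: finite_subset)
  have finL: "finite (?L T)" if "T \<in> ?S" for T using finT[OF that] by simp
  have finI: "finite ?I" using finS finL by (intro finite_cartesian_product finite_SigmaI) auto
  have B: "?B i \<in> events" for i by (cases i) (auto simp: case_prod_beta)
  have "{\<omega> \<in> space M. \<not> skewed a k (H \<omega>)} \<subseteq> ?none \<union> (\<Union>i\<in>?I. ?B i)"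
  proof
    fix \<omega> assume "\<omega> \<in> {\<omega> \<in> space M. \<not> skewed a k (H \<omega>)}"
    then have \<omega>: "\<omega> \<in> space M" and bad: "\<not> skewed a k (H \<omega>)" by auto
    show "\<omega> \<in> ?none \<union> (\<Union>i\<in>?I. ?B i)"
    proof (cases "\<omega> \<in> ?none")
      case False
      then obtain v where "v \<in> {1..n}" "server_deg (H \<omega>) v = D" using \<omega> by auto
      from not_skewedE[OF \<omega> a kD this bad] obtain u T L where
        "u \<in> {1..n}" "T \<subseteq> {1..n}" "card T = D" "L \<subseteq> T" "card L = k"
        "\<forall>d\<in>T. (d, u) \<in> edges (H \<omega>)" "\<forall>d\<in>T - L. \<exists>w\<in>{1..n} - {u}. (d, w) \<in> edges (H \<omega>)" .
      then have "(u, T, L) \<in> ?I" "\<omega> \<in> ?B (u, T, L)" using \<omega> by auto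
      then show ?thesis by blast
    qed simp
  qed
  then have "prob {\<omega> \<in> space M. \<not> skewed a k (H \<omega>)} \<le> prob (?none \<union> (\<Union>i\<in>?I. ?B i))"
    using B finI by (intro finite_measure_mono sets.Un sets.finite_UN event) auto
  also have "\<dots> \<le> prob ?none + prob (\<Union>i\<in>?I. ?B i)"
    using B finI by (intro measure_Un_le sets.finite_UN event) auto
  also have "prob (\<Union>i\<in>?I. ?B i) \<le> (\<Sum>i\<in>?I. prob (?B i))"
    using B finI by (intro finite_measure_subadditive_finite) auto
  also have "\<dots> = (\<Sum>i\<in>?I. ?c)"
    by (rule sum.cong) (auto simp: prob_many_shared_nbrs simp del: One_nat_def)
  also have "\<dots> = real (card ?I) * ?c" by simp
  also have "card ?I = n * ((n choose D) * (D choose k))"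
    using finT finS finL by (simp add: card_cartesian_product n_subsets card_SigmaI)
  also have "real (n * ((n choose D) * (D choose k))) * ?c
      = real n * (n choose D) * (D choose k) * p ^ D * (1 - (1 - p) ^ (n - 1)) ^ (D - k)"
    by simp
  finally show ?thesis using prob_all_server_deg_ne_le[of D] by linarith
qed

end

section \<open>Estimates along the sparse sequence of sizes\<close>

text \<open>For k \<le> n the right-hand side is the falling factorial n (n - 1) ... (n - k + 1),
  each of whose k factors is at least n - k. For n < k truncated subtraction makes the left-hand
  side 0.\<close>

lemma diff_power_le_binomial_fact: "(n - k) ^ k \<le> (n choose k) * fact k"
proof (induction k arbitrary: n)
  case (Suc k)
  show ?case
  proof (cases n)
    case (Suc m)
    have "(n - Suc k) ^ Suc k \<le> (m - k) * ((m choose k) * fact k)"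
      using Suc.IH[of m] Suc by simp
    also have "\<dots> \<le> Suc m * ((m choose k) * fact k)" by (intro mult_le_mono1) simp
    also have "\<dots> = (n choose Suc k) * fact (Suc k)"
      using Suc Suc_times_binomial_eq[of m k] by (simp add: algebra_simps)
    finally show ?thesis .
  qed simp
qed simp

text \<open>Cancelling n against n! leaves b times the preceding term of the exponential series, and
  the terms of a convergent series vanish in the limit.\<close>

lemma real_mult_power_div_fact_tendsto_0: "(\<lambda>n. real n * (b ^ n / fact n)) \<longlonglongrightarrow> 0" for b :: real
proof (rule LIMSEQ_imp_Suc)
  have "(\<lambda>n. b * (b ^ n / fact n)) \<longlonglongrightarrow> b * 0"
    using summable_exp[of b] by (intro tendsto_mult tendsto_const summable_LIMSEQ_zero) (simp add: field_simps)
  then show "(\<lambda>n. real (Suc n) * (b ^ Suc n / fact (Suc n))) \<longlonglongrightarrow> 0"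
    by (simp add: field_simps del: of_nat_Suc)
qed

lemma polynomial_mult_geometric_tendsto_0:
  fixes c C :: real
  assumes "0 < c" "c < 1"
  shows "(\<lambda>n. (real n + C) * real n ^ k * c ^ (n - k)) \<longlonglongrightarrow> 0"
proof -
  have "(\<lambda>n. (real n + C) * real n ^ k * c ^ n / c ^ k) \<longlonglongrightarrow> 0"
    using assms by real_asymp
  moreover have "eventually (\<lambda>n. (real n + C) * real n ^ k * c ^ n / c ^ k
      = (real n + C) * real n ^ k * c ^ (n - k)) sequentially"
    using eventually_ge_at_top[of k] by eventually_elim (use assms in \<open>simp add: power_diff\<close>)
  ultimately show ?thesis by (rule Lim_transform_eventually)
qed


text \<open>With this choice of \<open>n\<close> the expected number \<open>n C(n,D) (b/n)\<^sup>D\<close> of \<open>D\<close>-sets of neighbours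
  is of order \<open>D\<close>.\<close>

definition sparse_size :: "real \<Rightarrow> nat \<Rightarrow> nat" where
  "sparse_size b D = nat \<lceil>real D * fact D / b ^ D\<rceil>"

lemma sparse_size_ge: "real D * fact D / b ^ D \<le> real (sparse_size b D)"
  unfolding sparse_size_def by linarith

text \<open>Without the ceiling the product would be exactly \<open>D\<close>. Rounding adds at most
  one unit to the size, hence at most b^D / D! to the product, and this is a single term of the
  series of \<open>exp b\<close>.\<close>

lemma sparse_size_mean:
  assumes "b > 0"
  shows "real D \<le> sparse_size b D * (b ^ D / fact D)"
    and "sparse_size b D * (b ^ D / fact D) \<le> real D + exp b"
proof -
  have pos: "b ^ D / fact D > 0" using assms by simp
  have D: "real D * fact D / b ^ D * (b ^ D / fact D) = D" using assms by simp
  show "real D \<le> sparse_size b D * (b ^ D / fact D)"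
    using mult_right_mono[OF sparse_size_ge[of D b], of "b ^ D / fact D"] pos D by linarith
  have "0 \<le> real D * fact D / b ^ D" using assms by simp
  then have "real (sparse_size b D) \<le> real D * fact D / b ^ D + 1"
    unfolding sparse_size_def by linarith
  then have "sparse_size b D * (b ^ D / fact D) \<le> (real D * fact D / b ^ D + 1) * (b ^ D / fact D)"
    using pos by (intro mult_right_mono) auto
  also have "\<dots> = D + b ^ D / fact D" using D by (simp only: distrib_right mult_1)
  also have "b ^ D / fact D \<le> exp b"
  proof -
    have sums: "(\<lambda>n. b ^ n / fact n) sums exp b"
      using exp_converges[of b] by (simp add: field_simps scaleR_conv_of_real)
    have "(\<Sum>n\<in>{D}. b ^ n / fact n) \<le> suminf (\<lambda>n. b ^ n / fact n)"
      using assms sums by (intro sum_le_suminf) (auto simp: sums_iff)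
    then show ?thesis using sums by (simp add: sums_iff)
  qed
  finally show "sparse_size b D * (b ^ D / fact D) \<le> real D + exp b" by simp
qed

text \<open>This supplies the size condition of \<open>bounds_of_sparse\<close>. It holds because D!
  / b^D eventually exceeds 2 D.\<close>

lemma sparse_size_ge_square:
  assumes "b > 0"
  shows "\<forall>\<^sub>F D in sequentially. 2 * real D ^ 2 \<le> sparse_size b D"
proof -
  have "\<forall>\<^sub>F D in sequentially. real D * (b ^ D / fact D) < 1 / 2"
    by (rule order_tendstoD(2)[OF real_mult_power_div_fact_tendsto_0]) simp
  then show ?thesis
  proof eventually_elim
    case (elim D)
    have "2 * real D * b ^ D \<le> fact D" using elim by (simp add: field_simps)
    then have "real D * (2 * real D * b ^ D) \<le> real D * fact D" by (intro mult_left_mono) auto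
    then have "2 * real D ^ 2 \<le> real D * fact D / b ^ D"
      using assms by (simp add: field_simps power2_eq_square)
    then show ?case using sparse_size_ge[of D b] by linarith
  qed
qed

lemma filterlim_sparse_size:
  assumes "b > 0"
  shows "filterlim (sparse_size b) at_top sequentially"
proof (rule filterlim_at_top_mono[OF filterlim_ident])
  show "\<forall>\<^sub>F D in sequentially. D \<le> sparse_size b D"
    using sparse_size_ge_square[OF assms]
  proof eventually_elim
    case (elim D)
    have "real D \<le> 2 * real D ^ 2" by (cases D) (auto simp: power2_eq_square algebra_simps)
    with elim show ?case by linarith
  qed
qed

text \<open>Once 2 D^2 \<le> n, the factor C(n,D) (b/n)^D lies between half of b^D / D! and b^D /
  D!. Since powers of 1 - b/n grow as the exponent shrinks, the one constant \<open>c\<close> bounds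
  both the power n - D and the power n - 1 from below.\<close>

lemma bounds_of_sparse:
  fixes b c :: real and n D k :: nat
  assumes b: "b > 0" and n: "b \<le> real n" and D: "2 * real D ^ 2 \<le> n" and kD: "k \<le> D"
    and c: "c > 0" "c \<le> (1 - b / n) ^ n"
  shows "n * ((n choose D) * (b / n) ^ D * (1 - b / n) ^ (n - D)) \<ge> n * (b ^ D / fact D) * c / 2"
    and "real n * (n choose D) * (D choose k) * (b / n) ^ D * (1 - (1 - b / n) ^ (n - 1)) ^ (D - k)
      \<le> n * (b ^ D / fact D) * real D ^ k * (1 - c) ^ (D - k)"
proof -
  have n0: "real n > 0" using b n by linarith
  have p: "0 \<le> 1 - b / n" "1 - b / n \<le> 1" using b n n0 by (auto simp: field_simps)
  have Dn: "D \<le> n"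
  proof -
    have "real D \<le> 2 * real D ^ 2" by (cases D) (auto simp: power2_eq_square algebra_simps)
    with D show ?thesis by linarith
  qed
  \<comment> \<open>Bernoulli's inequality gives (1 - D/n)^D \<ge> 1 - D^2/n, which is at least 1/2:
    replacing n^D by (n - D)^D loses at most a factor of 2.\<close>
  have "1 / 2 \<le> 1 + real D * (- (real D / n))"
    using D n0 by (simp add: field_simps power2_eq_square)
  also have "\<dots> \<le> (1 + - (real D / n)) ^ D"
    using Dn n0 by (intro Bernoulli_inequality) auto
  also have "\<dots> = real (n - D) ^ D / n ^ D"
    using Dn n0 by (simp add: power_divide[symmetric] diff_divide_distrib of_nat_diff)
  finally have half: "1 / 2 \<le> real (n - D) ^ D / n ^ D" .
  have ch: "real (n - D) ^ D \<le> (n choose D) * fact D"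
    using diff_power_le_binomial_fact[of n D] by (metis of_nat_fact of_nat_le_iff of_nat_mult of_nat_power)
  have "b ^ D / fact D * (1 / 2) \<le> b ^ D / fact D * (real (n - D) ^ D / n ^ D)"
    using half b by (intro mult_left_mono) auto
  also have "\<dots> \<le> b ^ D / fact D * (((n choose D) * fact D) / n ^ D)"
    using ch b by (intro mult_left_mono divide_right_mono) auto
  also have "\<dots> = (n choose D) * (b / n) ^ D" by (simp add: power_divide)
  finally have lower: "b ^ D / fact D * (1 / 2) \<le> (n choose D) * (b / n) ^ D" .
  have "c \<le> (1 - b / n) ^ (n - D)"
    using c(2) power_decreasing[of "n - D" n "1 - b / n"] p by simp
  then have "b ^ D / fact D * (1 / 2) * c \<le> (n choose D) * (b / n) ^ D * (1 - b / n) ^ (n - D)"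
    using b c(1) by (intro mult_mono[OF lower]) auto
  then have "n * (b ^ D / fact D * (1 / 2) * c) \<le> n * ((n choose D) * (b / n) ^ D * (1 - b / n) ^ (n - D))"
    by (rule mult_left_mono) simp
  then show "n * ((n choose D) * (b / n) ^ D * (1 - b / n) ^ (n - D)) \<ge> n * (b ^ D / fact D) * c / 2"
    by (simp add: mult.assoc)
  have "real (n choose D) * fact D \<le> real n ^ D"
    using binomial_fact_pow[of n D] by (metis of_nat_fact of_nat_le_iff of_nat_mult of_nat_power)
  then have "(n choose D) * (b / n) ^ D \<le> b ^ D / fact D"
    using n0 b by (simp add: field_simps power_divide)
  moreover have "real (D choose k) \<le> real D ^ k"
    using binomial_le_pow[OF kD] by (metis of_nat_le_iff of_nat_power)
  moreover have "(1 - (1 - b / n) ^ (n - 1)) ^ (D - k) \<le> (1 - c) ^ (D - k)"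
    using c(2) power_decreasing[of "n - 1" n "1 - b / n"] p power_le_one[of "1 - b / n" "n - 1"]
    by (intro power_mono) auto
  moreover have "0 \<le> (1 - (1 - b / n) ^ (n - 1)) ^ (D - k)"
    using p power_le_one[of "1 - b / n" "n - 1"] by simp
  ultimately have "n * ((n choose D) * (b / n) ^ D) * (D choose k) * (1 - (1 - b / n) ^ (n - 1)) ^ (D - k)
      \<le> n * (b ^ D / fact D) * real D ^ k * (1 - c) ^ (D - k)"
    using b by (intro mult_mono mult_left_mono) auto
  then show "real n * (n choose D) * (D choose k) * (b / n) ^ D * (1 - (1 - b / n) ^ (n - 1)) ^ (D - k)
      \<le> n * (b ^ D / fact D) * real D ^ k * (1 - c) ^ (D - k)"
    by (simp add: mult_ac)
qed

text \<open>\<open>bound\<close> is the estimate of \<open>prob_not_skewed_le\<close>. Along the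
  sparse sizes, n b^D / D! lies between D and D + exp b, so the first term decays like exp (- D c /
  2), while the second is at most a polynomial in D times a power of 1 - c.\<close>

lemma sparse_bound_tendsto_0:
  fixes b :: real and p :: "nat \<Rightarrow> real" and bound :: "nat \<Rightarrow> nat \<Rightarrow> real" and k :: nat
  assumes b: "b > 0"
  defines "p \<equiv> \<lambda>n :: nat. b / real n"
  defines "bound \<equiv> \<lambda>n D :: nat. exp (- (n * ((n choose D) * p n ^ D * (1 - p n) ^ (n - D))))
      + real n * (n choose D) * (D choose k) * p n ^ D * (1 - (1 - p n) ^ (n - 1)) ^ (D - k)"
  shows "(\<lambda>D. bound (sparse_size b D) D) \<longlonglongrightarrow> 0"
proof -
  \<comment> \<open>Any positive number strictly below exp (- b), the limit of (1 - b/n)^n, is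
    eventually a lower bound for these powers; half the limit is one such choice and is also below
    1.\<close>
  define c where "c = exp (- b) / 2"
  have c: "0 < c" "c < 1" using b by (auto simp: c_def field_simps intro: less_trans[of _ 1])
  let ?N = "sparse_size b" and ?g = "\<lambda>D. exp (- (D * c / 2)) + (real D + exp b) * real D ^ k * (1 - c) ^ (D - k)"
  have "(\<lambda>n. (1 + - b / n) ^ n) \<longlonglongrightarrow> exp (- b)" by (rule tendsto_exp_limit_sequentially)
  then have "(\<lambda>D. (1 + - b / ?N D) ^ ?N D) \<longlonglongrightarrow> exp (- b)"
    by (rule filterlim_compose) (rule filterlim_sparse_size[OF b])
  then have ev_c: "\<forall>\<^sub>F D in sequentially. c < (1 + - b / ?N D) ^ ?N D"
    by (rule order_tendstoD) (simp add: c_def)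
  have ev_b: "\<forall>\<^sub>F D in sequentially. b \<le> ?N D"
    using filterlim_compose[OF filterlim_real_sequentially filterlim_sparse_size[OF b]]
    by (simp add: filterlim_at_top)
  have upper: "\<forall>\<^sub>F D in sequentially. bound (?N D) D \<le> ?g D \<and> 0 \<le> bound (?N D) D"
    using ev_c ev_b sparse_size_ge_square[OF b] eventually_ge_at_top[of k]
  proof eventually_elim
    case (elim D)
    let ?n = "?N D"
    let ?x = "?n * (b ^ D / fact D)"
    have n0: "real ?n > 0" using b elim(2) by linarith
    have p: "0 \<le> 1 - p ?n" "1 - p ?n \<le> 1" "0 \<le> p ?n" using b elim(2) n0 by (auto simp: p_def field_simps)
    have B: "?n * ((?n choose D) * p ?n ^ D * (1 - p ?n) ^ (?n - D)) \<ge> ?x * c / 2"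
      "real ?n * (?n choose D) * (D choose k) * p ?n ^ D * (1 - (1 - p ?n) ^ (?n - 1)) ^ (D - k)
        \<le> ?x * real D ^ k * (1 - c) ^ (D - k)"
      using bounds_of_sparse[OF b elim(2,3,4) c(1)] elim(1) by (auto simp: p_def)
    have "D * c / 2 \<le> ?x * c / 2"
      using sparse_size_mean(1)[OF b, of D] c by (intro divide_right_mono mult_right_mono) auto
    from order_trans[OF this B(1)] have 1: "exp (- (?n * ((?n choose D) * p ?n ^ D * (1 - p ?n) ^ (?n - D)))) \<le> exp (- (D * c / 2))"
      by (simp only: exp_le_cancel_iff neg_le_iff_le)
    have "?x * real D ^ k * (1 - c) ^ (D - k) \<le> (real D + exp b) * real D ^ k * (1 - c) ^ (D - k)"
      using sparse_size_mean(2)[OF b, of D] c by (intro mult_right_mono) auto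
    from add_mono[OF 1 order_trans[OF B(2) this]] have "bound ?n D \<le> ?g D"
      by (simp only: bound_def)
    moreover have "0 \<le> bound ?n D"
      using p power_le_one[OF p(1,2), of "?n - 1"] unfolding bound_def
      by (intro add_nonneg_nonneg mult_nonneg_nonneg) auto
    ultimately show ?case by blast
  qed
  have "(\<lambda>D. exp (- (real D * c / 2))) \<longlonglongrightarrow> 0" using c by real_asymp
  from tendsto_add[OF this polynomial_mult_geometric_tendsto_0[of "1 - c" "exp b" k]]
  have "?g \<longlonglongrightarrow> 0" using c by simp
  then show ?thesis
    by (rule tendsto_sandwich[rotated 3, where f = "\<lambda>_. 0"]) (use upper in \<open>auto elim: eventually_mono\<close>)
qed

section \<open>From vanishing probabilities to an infinite index set\<close>

text \<open>Failure at every index from \<open>m\<close> on entails failure at \<open>N i\<close>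
  for each large \<open>i\<close>, so its probability is bounded by a sequence tending to 0.\<close>

lemma (in prob_space) AE_ex_ge_of_prob_tendsto_0:
  fixes P :: "nat \<Rightarrow> 'a \<Rightarrow> bool"
  assumes events: "\<And>n. {\<omega> \<in> space M. \<not> P n \<omega>} \<in> events"
    and N: "filterlim N at_top sequentially"
    and lim: "(\<lambda>i. prob {\<omega> \<in> space M. \<not> P (N i) \<omega>}) \<longlonglongrightarrow> 0"
  shows "AE \<omega> in M. \<exists>n\<ge>m. P n \<omega>"
proof -
  let ?B = "\<lambda>n. {\<omega> \<in> space M. \<not> P n \<omega>}"
  let ?S = "\<Inter>n\<in>{m..}. ?B n"
  have S: "?S \<in> events" using events by (intro sets.countable_INT) auto
  have "\<forall>\<^sub>F i in sequentially. prob ?S \<le> prob (?B (N i))"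
    using N[unfolded filterlim_at_top, rule_format, of m]
    by eventually_elim (intro finite_measure_mono events, auto)
  then have "prob ?S \<le> 0" by (intro tendsto_lowerbound[OF lim]) auto
  then have "emeasure M ?S = 0" by (simp add: emeasure_eq_measure order_antisym)
  with S have "?S \<in> null_sets M" by (simp add: null_sets_def)
  then show ?thesis by (rule AE_I') auto
qed

text \<open>Diagonal choice: pick \<open>r\<close> strictly increasing with
  \<open>P k (r k)\<close>. A member \<open>r j\<close> of the range with r j \<ge> r Z has j \<ge>
  Z, hence f (r j) \<ge> j \<ge> Z.\<close>

lemma ex_filterlim_of_frequently:
  fixes P :: "nat \<Rightarrow> nat \<Rightarrow> bool" and f :: "nat \<Rightarrow> nat"
  assumes P: "\<And>k m. \<exists>n\<ge>m. P k n" and f: "\<And>k n. P k n \<Longrightarrow> k \<le> f n \<and> n \<in> A"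
  shows "\<exists>I. infinite I \<and> I \<subseteq> A \<and> filterlim f at_top (inf sequentially (principal I))"
proof -
  have "\<exists>r. \<forall>k. P k (r k) \<and> r k < r (Suc k)"
    by (rule dependent_nat_choice) (use P in \<open>auto simp: Suc_le_eq[symmetric]\<close>)
  then obtain r where r: "\<And>k. P k (r k)" "\<And>k. r k < r (Suc k)" by blast
  have mono: "strict_mono r" using r(2) by (simp add: strict_mono_Suc_iff)
  have "filterlim f at_top (inf sequentially (principal (range r)))"
    unfolding filterlim_at_top eventually_inf_principal
  proof
    fix Z
    show "\<forall>\<^sub>F n in sequentially. n \<in> range r \<longrightarrow> Z \<le> f n"
      using eventually_ge_at_top[of "r Z"]
    proof eventually_elim
      case (elim n)
      then show ?case
        using strict_mono_less_eq[OF mono] f[OF r(1)] by (auto intro: order_trans)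
    qed
  qed
  moreover have "infinite (range r)"
    using mono by (simp add: finite_image_iff strict_mono_imp_inj_on)
  ultimately show ?thesis using f[OF r(1)] by blast
qed

section \<open>Almost sure skewness for the sequence of graphs\<close>

theorem theorem4:
  fixes M :: "'w measure"
    and G :: "nat \<Rightarrow> 'w \<Rightarrow> (nat, nat) bigraph"
    and u :: "nat \<Rightarrow> 'w \<Rightarrow> nat"
    and b lam mu :: real
    and a :: nat
  assumes "prob_space M"
    and "b > 0" and "lam > 0" and "mu > lam" and "a \<ge> 1"
    and "\<And>n \<omega>. b \<le> real n \<Longrightarrow> \<omega> \<in> space M \<Longrightarrow>
           wf_bigraph (G n \<omega>) \<and> dispatchers (G n \<omega>) = {1..n} \<and> servers (G n \<omega>) = {1..n}"
    and "\<And>n. b \<le> real n \<Longrightarrow>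
           prob_space.indep_vars M (\<lambda>_. borel)
             (\<lambda>e \<omega>. indicat_real (edges (G n \<omega>)) e) ({1..n} \<times> {1..n})"
    and "\<And>n d v. b \<le> real n \<Longrightarrow> d \<in> {1..n} \<Longrightarrow> v \<in> {1..n} \<Longrightarrow>
           prob_space.expectation M (\<lambda>\<omega>. indicat_real (edges (G n \<omega>)) (d, v)) = b / real n"
    and "prob_space.indep_vars M (\<lambda>_. count_space UNIV) G {n. b \<le> real n}"
    and "\<And>n \<omega>. b \<le> real n \<Longrightarrow> \<omega> \<in> space M \<Longrightarrow> max_degree_server (G n \<omega>) (u n \<omega>)"
  shows "AE \<omega> in M. \<exists>I. infinite I \<and> I \<subseteq> {n. b \<le> real n} \<and>
           skewed_neighborhood I (\<lambda>n. G n \<omega>) (\<lambda>_ _. lam) (\<lambda>_ _. mu) (\<lambda>n. u n \<omega>) \<and>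
           filterlim (\<lambda>m. card (alpha_nbrs (G m \<omega>) (\<lambda>_. lam) (\<lambda>_. mu) (a, lam, mu) (u m \<omega>)))
             at_top (inf sequentially (principal I))"
proof -
  interpret prob_space M by fact
  note b = \<open>b > 0\<close>
  note shape = assms(6) and graph_rv = assms(9)
  have bigraph: "random_bigraph M (G n) n (b / n)" if n: "b \<le> real n" for n
  proof
    show "G n \<in> measurable M (count_space UNIV)"
      using graph_rv n by (auto simp: indep_vars_def)
    show "dispatchers (G n \<omega>) = {1..n}" "servers (G n \<omega>) = {1..n}" if "\<omega> \<in> space M" for \<omega>
      using shape[OF n that] by auto
    \<comment> \<open>Testing the real indicator for the value 1 turns the given independence into
      independence of Boolean edge variables.\<close>
    have "indep_vars (\<lambda>_. count_space UNIV) (\<lambda>e \<omega>. indicat_real (edges (G n \<omega>)) e = 1) ({1..n} \<times> {1..n})"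
      by (rule indep_vars_compose2[OF assms(7)[OF n]]) measurable
    then show "indep_vars (\<lambda>_. count_space UNIV) (\<lambda>e \<omega>. e \<in> edges (G n \<omega>)) ({1..n} \<times> {1..n})"
      by (simp add: indicator_eq_1_iff)
    show "prob {\<omega> \<in> space M. e \<in> edges (G n \<omega>)} = b / n" if e: "e \<in> {1..n} \<times> {1..n}" for e
    proof -
      have "prob {\<omega> \<in> space M. e \<in> edges (G n \<omega>)}
          = expectation (indicat_real {\<omega>. e \<in> edges (G n \<omega>)})"
        by (simp add: Int_def conj_commute)
      also have "\<dots> = expectation (\<lambda>\<omega>. indicat_real (edges (G n \<omega>)) e)"
        by (intro Bochner_Integration.integral_cong) (auto simp: indicator_def)
      finally show ?thesis using assms(8)[OF n] e by auto
    qed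
  qed
  \<comment> \<open>The conjunct on \<open>b\<close> confines the indices to those where
    \<open>G n\<close> is specified; for n < b the failure event is the whole space, which is
    measurable.\<close>
  let ?P = "\<lambda>k n \<omega>. b \<le> real n \<and> skewed a k (G n \<omega>)"
  let ?N = "sparse_size b"
  have "AE \<omega> in M. \<exists>n\<ge>m. ?P k n \<omega>" for k m :: nat
  proof (rule AE_ex_ge_of_prob_tendsto_0[OF _ filterlim_sparse_size[OF b]])
    show "{\<omega> \<in> space M. \<not> ?P k n \<omega>} \<in> events" for n
      using random_bigraph.event[OF bigraph, of n "\<lambda>g. \<not> skewed a k g"] by (cases "b \<le> real n") auto
    have "\<forall>\<^sub>F D in sequentially. b \<le> ?N D"
      using filterlim_compose[OF filterlim_real_sequentially filterlim_sparse_size[OF b]]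
      by (simp add: filterlim_at_top)
    then have "\<forall>\<^sub>F D in sequentially. prob {\<omega> \<in> space M. \<not> ?P k (?N D) \<omega>}
      \<le> exp (- (real (?N D) * (real (?N D choose D) * (b / ?N D) ^ D * (1 - b / ?N D) ^ (?N D - D))))
        + real (?N D) * real (?N D choose D) * real (D choose k) * (b / ?N D) ^ D
          * (1 - (1 - b / ?N D) ^ (?N D - 1)) ^ (D - k)"
      using eventually_ge_at_top[of k]
    proof eventually_elim
      case (elim D)
      with random_bigraph.prob_not_skewed_le[OF bigraph[OF elim(1)] \<open>a \<ge> 1\<close> elim(2)]
      show ?case by simp
    qed
    then show "(\<lambda>D. prob {\<omega> \<in> space M. \<not> ?P k (?N D) \<omega>}) \<longlonglongrightarrow> 0"
      by (rule tendsto_sandwich[OF _ _ tendsto_const sparse_bound_tendsto_0[OF b], rotated]) simp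
  qed
  \<comment> \<open>Only countably many pairs of \<open>k\<close> and \<open>m\<close> occur, so one
    null set serves them all; this allows \<open>k\<close> to grow along the index set chosen for a
    fixed outcome.\<close>
  then have "AE \<omega> in M. \<forall>k m. \<exists>n\<ge>m. ?P k n \<omega>" by (simp add: AE_all_countable)
  then show ?thesis
  proof (rule AE_mp, intro AE_I2 impI)
    fix \<omega> assume \<omega>: "\<omega> \<in> space M" and freq: "\<forall>k m. \<exists>n\<ge>m. ?P k n \<omega>"
    let ?f = "\<lambda>m. card (alpha_nbrs (G m \<omega>) (\<lambda>_. lam) (\<lambda>_. mu) (a, lam, mu) (u m \<omega>))"
    \<comment> \<open>With constant rates the two rate conditions in \<open>alpha_nbrs\<close> hold
      with equality, leaving only the degree condition that \<open>skewed\<close> counts.\<close>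
    have "k \<le> ?f n \<and> n \<in> {n. b \<le> real n}" if "?P k n \<omega>" for k n
      using that assms(10)[OF _ \<omega>, of n] by (auto simp: skewed_def alpha_nbrs_def)
    with freq obtain I where "infinite I" "I \<subseteq> {n. b \<le> real n}"
      and "filterlim ?f at_top (inf sequentially (principal I))"
      using ex_filterlim_of_frequently[of "\<lambda>k n. ?P k n \<omega>" ?f "{n. b \<le> real n}"] by blast
    then show "\<exists>I. infinite I \<and> I \<subseteq> {n. b \<le> real n} \<and>
        skewed_neighborhood I (\<lambda>n. G n \<omega>) (\<lambda>_ _. lam) (\<lambda>_ _. mu) (\<lambda>n. u n \<omega>) \<and>
        filterlim ?f at_top (inf sequentially (principal I))"
      unfolding skewed_neighborhood_def by blast
  qed
qed

end
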